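(* Let $\varphi(z)=1+B_1z+B_2z^2+\cdots$ be as in the context, with $3B_1^2\ge 8B_2$, and let $$\sigma_2=\frac{2(17B_1^2+3B_1^3-8B_1B_2)}{3B_1^3-8B_1B_2+3B_1^2B_2-4B_2^2}.$$ If $f\in\mathcal{C}_s(\varphi)$, then: (1) if $\sigma_2\notin[0,4]$, then $$T_{3,1}(f)\ge\min\left\{1-\frac{B_1^2}{144},\;1+\frac{1}{144}\big(3B_1^2(B_2-6)-4B_2^2\big)\right\};$$ (2) if $\sigma_2=4$, then $$T_{3,1}(f)\ge 1+\frac{1}{144}\big(3B_1^2(B_2-6)-4B_2^2\big);$$ (3) if $\sigma_2\in(0,4)$, then $$T_{3,1}(f)\ge 1-\frac{B_1^2\,(9B_1^4+114B_1^3+289B_1^2-304B_1B_2-36B_1^2B_2+48B_2^2)}{576\,(3B_1^3-8B_1B_2+3B_1^2B_2-4B_2^2)}.$$ The first two inequalities, (1) and (2), are sharp, i.e. equality holds for some $f\in\mathcal{C}_s(\varphi)$.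
   Context: $\mathbb{D}$ is the open unit disk in $\mathbb{C}$, and $\mathcal{A}$ is the class of holomorphic functions $f$ on $\mathbb{D}$ with $f(0)=f'(0)-1=0$. The function $\varphi$ is analytic and univalent in $\mathbb{D}$ with $\varphi(0)=1$, $\operatorname{Re}\varphi(z)>0$ on $\mathbb{D}$, $\varphi(\mathbb{D})$ starlike with respect to $\varphi(0)=1$ and symmetric with respect to the real axis, and $\varphi(z)=1+B_1z+B_2z^2+\cdots$ with $B_1>0$ (so all $B_n$ are real). The symbol $\prec$ denotes subordination: $g\prec\varphi$ means $g=\varphi\circ\omega$ for some analytic $\omega:\mathbb{D}\to\mathbb{D}$ with $\omega(0)=0$. The class $\mathcal{C}_s(\varphi)$ consists of all $f\in\mathcal{A}$ such that $\dfrac{(2zf'(z))'}{(f(z)-f(-z))'}\prec\varphi(z)$. For $f(z)=z+a_2z^2+a_3z^3+\cdots\in\mathcal{A}$, the third order Hermitian-Toeplitz determinant is $T_{3,1}(f)=1-2\lvert a_2\rvert^2+2\operatorname{Re}(a_2^2\overline{a_3})-\lvert a_3\rvert^2$. *)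

theory Defs
  imports "HOL-Complex_Analysis.Complex_Analysis"
begin

abbreviation unit_disk :: "complex set" where
  "unit_disk \<equiv> ball 0 1"

definition taylor_coeff :: "(complex \<Rightarrow> complex) \<Rightarrow> nat \<Rightarrow> complex" where
  "taylor_coeff f n = (deriv ^^ n) f 0 / fact n"

definition class_A :: "(complex \<Rightarrow> complex) set" where
  "class_A = {f. f holomorphic_on unit_disk \<and> f 0 = 0 \<and> deriv f 0 - 1 = 0}"

definition subordinate :: "(complex \<Rightarrow> complex) \<Rightarrow> (complex \<Rightarrow> complex) \<Rightarrow> bool" where
  "subordinate g \<phi> \<longleftrightarrow>
     (\<exists>\<omega>. \<omega> holomorphic_on unit_disk \<and> \<omega> ` unit_disk \<subseteq> unit_disk \<and> \<omega> 0 = 0 \<and>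
          (\<forall>z\<in>unit_disk. g z = \<phi> (\<omega> z)))"

text \<open>
  The library predicate \<open>starlike\<close> leaves the centre existentially quantified, so starlikeness
  with respect to the point 1 is spelled out.  Only the reality and positivity of the first
  coefficient are required; that the remaining coefficients are real is a consequence of the
  symmetry of the image.
\<close>

definition ma_minda :: "(complex \<Rightarrow> complex) \<Rightarrow> bool" where
  "ma_minda \<phi> \<longleftrightarrow>
     \<phi> holomorphic_on unit_disk \<and> inj_on \<phi> unit_disk \<and> \<phi> 0 = 1 \<and>
     (\<forall>z\<in>unit_disk. Re (\<phi> z) > 0) \<and>
     (\<forall>w\<in>\<phi> ` unit_disk. closed_segment 1 w \<subseteq> \<phi> ` unit_disk) \<and>
     cnj ` (\<phi> ` unit_disk) = \<phi> ` unit_disk \<and>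
     taylor_coeff \<phi> 1 \<in> \<real> \<and> Re (taylor_coeff \<phi> 1) > 0"

text \<open>
  Since \<open>x / 0 = 0\<close>, a zero of the denominator would give the quotient the value 0, which
  \<open>\<phi>\<close>, having positive real part, does not take.  Membership for such \<open>\<phi>\<close> therefore
  includes that the denominator has no zero in the disk.
\<close>

definition class_Cs :: "(complex \<Rightarrow> complex) \<Rightarrow> (complex \<Rightarrow> complex) set" where
  "class_Cs \<phi> = {f \<in> class_A.
     subordinate
       (\<lambda>z. deriv (\<lambda>w. 2 * w * deriv f w) z / deriv (\<lambda>w. f w - f (- w)) z) \<phi>}"

text \<open>
  This is the determinant of the Hermitian Toeplitz matrix with first row \<open>1, a\<^sub>2, a\<^sub>3\<close>.
\<close>

definition T31 :: "(complex \<Rightarrow> complex) \<Rightarrow> real" where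
  "T31 f = (let a2 = taylor_coeff f 2; a3 = taylor_coeff f 3 in
     1 - 2 * (cmod a2)\<^sup>2 + 2 * Re (a2\<^sup>2 * cnj a3) - (cmod a3)\<^sup>2)"

end

theory Submission
  imports Defs
begin

text \<open>
  Let \<open>f\<close> belong to the class through the Schwarz function
  \<open>\<omega>(z) = c\<^sub>1 z + c\<^sub>2 z\<^sup>2 + \<dots>\<close>. Comparing power series in
  \<open>(2zf'(z))' = \<phi>(\<omega>(z)) (f(z) - f(-z))'\<close> gives \<open>a\<^sub>2 = B\<^sub>1c\<^sub>1 / 4\<close> and
  \<open>a\<^sub>3 = (B\<^sub>1c\<^sub>2 + B\<^sub>2c\<^sub>1\<^sup>2) / 6\<close> (lemma \<open>class_Cs_coeffs\<close>), so with \<open>t = |c\<^sub>1|\<^sup>2\<close>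
  \<open>144 (T - 1) = - 18B\<^sub>1\<^sup>2 t + (3B\<^sub>1\<^sup>2B\<^sub>2 - 4B\<^sub>2\<^sup>2) t\<^sup>2 + B\<^sub>1(3B\<^sub>1\<^sup>2 - 8B\<^sub>2) Re (c\<^sub>1\<^sup>2 cnj c\<^sub>2) - 4B\<^sub>1\<^sup>2 |c\<^sub>2|\<^sup>2\<close>.
  By hypothesis the coefficient of the real part is nonnegative, and \<open>|c\<^sub>2| \<le> 1 - t\<close> by the
  Schwarz--Pick inequality (lemma \<open>schwarz_second_coeff\<close>). Hence the right-hand side is bounded
  below by the quadratic polynomial in \<open>t\<close> that arises for \<open>|c\<^sub>2| = 1 - t\<close> and
  \<open>c\<^sub>1\<^sup>2 cnj c\<^sub>2 = - t (1 - t)\<close>.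

  The decisive observation is that on \<open>[0,1]\<close> this polynomial is smallest at \<open>t = 1\<close>. Since
  \<open>\<phi>\<close> has positive real part, \<open>B\<^sub>1 \<le> 2\<close> (lemma \<open>caratheodory_first_coeff\<close>). Completing the
  square in \<open>B\<^sub>2\<close> then yields
  \<open>2 (3B\<^sub>1\<^sup>2B\<^sub>2 - 4B\<^sub>2\<^sup>2) + B\<^sub>1(3B\<^sub>1\<^sup>2 - 8B\<^sub>2) < 17 B\<^sub>1\<^sup>2\<close> (lemma
  \<open>ma_minda_quadratic_bound\<close>), which puts the minimum at \<open>t = 1\<close>. So
  \<open>T \<ge> 1 + (3B\<^sub>1\<^sup>2(B\<^sub>2 - 6) - 4B\<^sub>2\<^sup>2) / 144\<close> for every \<open>f\<close> in the class. This number is below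
  \<open>1 - B\<^sub>1\<^sup>2 / 144\<close>, because \<open>B\<^sub>2 \<le> 3B\<^sub>1\<^sup>2 / 8 \<le> 3 / 2\<close>; it is therefore the smaller
  of the two numbers when \<open>\<sigma>\<^sub>2\<close> lies outside \<open>[0,4]\<close>. The same quadratic inequality shows that
  \<open>\<sigma>\<^sub>2\<close> never lies strictly between 0 and 4: that would need a positive denominator of more
  than a quarter of the numerator.

  Equality holds for \<open>\<omega>(z) = z\<close>, where \<open>t = 1\<close>; the function \<open>f\<close> belonging to it is
  obtained by solving the differential equation (lemma \<open>class_Cs_ode_solvable\<close>). Finally,
  \<open>B\<^sub>2\<close> is defined as a real part, so that \<open>\<phi>\<close> has real coefficients must be deduced from the
  symmetry of its image (lemma \<open>symmetric_univalent_coeff_real\<close>).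
\<close>

section \<open>Coefficient bounds from the Schwarz lemma\<close>

lemma taylor_coeff_eq_fps_nth:
  assumes "f has_fps_expansion F"
  shows "taylor_coeff f n = fps_nth F n"
  using fps_nth_fps_expansion[OF assms] by (simp add: taylor_coeff_def)

lemma eventually_nhds_0_unit_disk:
  assumes "\<And>z. z \<in> unit_disk \<Longrightarrow> P z"
  shows "\<forall>\<^sub>F z in nhds 0. P z"
  using eventually_nhds_in_open[of unit_disk 0] assms by (auto elim: eventually_mono)

text \<open>
  The Cayley transform \<open>w \<mapsto> (w - 1) / (w + 1)\<close> takes the right half-plane to the disk and 1 to 0,
  and its derivative at 1 is \<open>1/2\<close>; the Schwarz lemma applies to its composition with \<open>p\<close>.
\<close>

lemma caratheodory_first_coeff:
  assumes hol: "p holomorphic_on unit_disk" and p0: "p 0 = 1"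
    and pos: "\<And>z. z \<in> unit_disk \<Longrightarrow> Re (p z) > 0"
  shows "cmod (deriv p 0) \<le> 2"
proof -
  define q where "q = (\<lambda>z. (p z - 1) / (p z + 1))"
  have nz: "p z + 1 \<noteq> 0" if "z \<in> unit_disk" for z
    using pos[OF that] by (auto simp: complex_eq_iff)
  have holq: "q holomorphic_on unit_disk"
    unfolding q_def using nz by (intro holomorphic_intros hol) auto
  have q0: "q 0 = 0" by (simp add: q_def p0)
  have qlt: "norm (q z) < 1" if "norm z < 1" for z
  proof -
    have z: "z \<in> unit_disk" using that by simp
    have "(norm (p z - 1))\<^sup>2 < (norm (p z + 1))\<^sup>2"
      using pos[OF z] by (simp only: cmod_power2) (simp add: power2_eq_square algebra_simps)
    then have "norm (p z - 1) < norm (p z + 1)"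
      by (rule power_less_imp_less_base) simp
    then show ?thesis
      using nz[OF z] by (simp add: q_def norm_divide)
  qed
  have dp: "(p has_field_derivative deriv p 0) (at 0)"
    using holomorphic_derivI[OF hol] by simp
  have "(q has_field_derivative deriv p 0 / 2) (at 0)"
    unfolding q_def by (rule derivative_eq_intros dp | simp add: p0)+
  then have "deriv q 0 = deriv p 0 / 2"
    by (rule DERIV_imp_deriv)
  then have "deriv p 0 = 2 * deriv q 0" by (simp add: field_simps)
  moreover have "norm (deriv q 0) \<le> 1"
    using Schwarz_Lemma(2)[OF holq q0 qlt, of 0] by simp
  ultimately show ?thesis by (simp add: norm_mult)
qed

text \<open>
  With \<open>\<omega>(z) = z h(z)\<close> the two coefficients are \<open>h(0)\<close> and \<open>h'(0)\<close>, so the claim is the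
  Schwarz--Pick inequality for \<open>h\<close> at 0. If \<open>|h(0)| < 1\<close>, then \<open>h\<close> maps the disk into itself,
  and the Schwarz lemma is applied to \<open>h\<close> followed by the disk automorphism that moves \<open>h(0)\<close>
  to 0. If \<open>|h(0)| = 1\<close>, then \<open>\<omega>\<close> is a rotation and its second coefficient vanishes.
\<close>

lemma schwarz_second_coeff:
  assumes hol: "\<omega> holomorphic_on unit_disk" and w0: "\<omega> 0 = 0"
    and lt: "\<And>z. z \<in> unit_disk \<Longrightarrow> norm (\<omega> z) < 1"
  shows "cmod (taylor_coeff \<omega> 2) \<le> 1 - (cmod (taylor_coeff \<omega> 1))\<^sup>2"
    and "cmod (taylor_coeff \<omega> 1) \<le> 1"
proof -
  obtain h where holh: "h holomorphic_on unit_disk"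
    and wh: "\<And>z. norm z < 1 \<Longrightarrow> \<omega> z = z * h z" and dw: "deriv \<omega> 0 = h 0"
    by (rule Schwarz3[OF hol w0]) blast
  define c where "c = h 0"
  have hexp: "h has_fps_expansion fps_expansion h 0"
    using holh by (intro has_fps_expansion_fps_expansion[of unit_disk]) auto
  have "(\<lambda>z. z * h z) has_fps_expansion fps_X * fps_expansion h 0"
    by (intro fps_expansion_intros hexp)
  moreover have "\<forall>\<^sub>F z in nhds 0. \<omega> z = z * h z"
    by (rule eventually_nhds_0_unit_disk) (simp add: wh)
  ultimately have wexp: "\<omega> has_fps_expansion fps_X * fps_expansion h 0"
    by (subst has_fps_expansion_cong[OF _ refl])
  have c1: "taylor_coeff \<omega> 1 = c"
    by (simp add: taylor_coeff_eq_fps_nth[OF wexp] fps_expansion_def c_def)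
  have c2: "taylor_coeff \<omega> 2 = deriv h 0"
    by (simp add: taylor_coeff_eq_fps_nth[OF wexp] fps_expansion_def numeral_2_eq_2)
  have lt': "norm (\<omega> z) < 1" if "norm z < 1" for z using lt[of z] that by simp
  note S = Schwarz_Lemma[OF hol w0 lt', simplified]
  show c_le: "cmod (taylor_coeff \<omega> 1) \<le> 1"
    using S(2)[of 0] dw c1 c_def by simp
  show "cmod (taylor_coeff \<omega> 2) \<le> 1 - (cmod (taylor_coeff \<omega> 1))\<^sup>2"
  proof (cases "norm c = 1")
    case True
    then obtain \<alpha> where \<alpha>: "\<And>z. norm z < 1 \<Longrightarrow> \<omega> z = \<alpha> * z"
      using S(3)[of 0] dw c_def by auto
    have "\<forall>\<^sub>F z in nhds 0. \<omega> z = \<alpha> * z"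
      by (rule eventually_nhds_0_unit_disk) (simp add: \<alpha>)
    moreover have "(\<lambda>z. \<alpha> * z) has_fps_expansion fps_const \<alpha> * fps_X"
      by (intro fps_expansion_intros)
    ultimately have "\<omega> has_fps_expansion fps_const \<alpha> * fps_X"
      by (subst has_fps_expansion_cong[OF _ refl])
    from taylor_coeff_eq_fps_nth[OF this, of 2] show ?thesis
      using True c1 by simp
  next
    case False
    then have c_lt: "norm c < 1" using c_le c1 by simp
    \<comment> \<open>Equality in the Schwarz lemma at one point would make \<open>\<omega>\<close> a rotation, hence \<open>|c| = 1\<close>;
      so it is strict, and \<open>h\<close> takes values in the open disk.\<close>
    have nrot: "norm (\<omega> z) \<noteq> norm z" if "norm z < 1" "z \<noteq> 0" for z
    proof
      assume "norm (\<omega> z) = norm z"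
      with that have "\<exists>z. norm z < 1 \<and> z \<noteq> 0 \<and> norm (\<omega> z) = norm z" by blast
      then obtain \<alpha> where \<alpha>: "\<And>z. norm z < 1 \<Longrightarrow> \<omega> z = \<alpha> * z" "norm \<alpha> = 1"
        using S(3)[of 0] by auto
      have "(\<omega> has_field_derivative \<alpha>) (at 0)"
        by (rule has_field_derivative_transform_within_open[of "\<lambda>z. \<alpha> * z" _ _ unit_disk])
          (auto intro!: derivative_eq_intros simp: \<alpha>)
      then show False using DERIV_imp_deriv[of \<omega> \<alpha> 0] dw c_def False \<alpha>(2) by simp
    qed
    have h_lt: "norm (h z) < 1" if "norm z < 1" for z
    proof (cases "z = 0")
      case True then show ?thesis using c_lt c_def by simp
    next
      case nz: False
      have "norm (\<omega> z) < norm z"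
        using S(1)[of z] nrot[OF that nz] that by simp
      then show ?thesis
        using nz wh[OF that] by (simp add: norm_mult)
    qed
    define k where "k = Moebius_function 0 c \<circ> h"
    have holk: "k holomorphic_on unit_disk"
      unfolding k_def using h_lt
      by (intro holomorphic_on_compose_gen[OF holh Moebius_function_holomorphic[OF c_lt]]) auto
    have k0: "k 0 = 0" by (simp add: k_def c_def Moebius_function_eq_zero)
    have k_lt: "norm (k z) < 1" if "norm z < 1" for z
      using Moebius_function_norm_lt_1[OF c_lt h_lt[OF that]] by (simp add: k_def)
    have dh: "(h has_field_derivative deriv h 0) (at 0)"
      using holomorphic_derivI[OF holh] by simp
    have cc: "cnj c * c = of_real ((norm c)\<^sup>2)"
      by (metis complex_norm_square mult.commute)
    have pos: "1 - (norm c)\<^sup>2 > 0"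
      using c_lt by (simp add: power_less_one_iff abs_square_less_1)
    have ne: "1 - cnj c * c \<noteq> 0"
      unfolding cc using pos by (metis less_irrefl of_real_1 of_real_diff of_real_eq_0_iff)
    have "(k has_field_derivative
        (deriv h 0 * (1 - cnj c * h 0) - (h 0 - c) * - (deriv h 0 * cnj c)) /
        ((1 - cnj c * h 0) * (1 - cnj c * h 0))) (at 0)"
      unfolding k_def o_def Moebius_function_simple
      using ne by (auto intro!: derivative_eq_intros dh simp: c_def)
    then have "(k has_field_derivative deriv h 0 / (1 - cnj c * c)) (at 0)"
      using ne by (simp add: c_def)
    then have "deriv k 0 = deriv h 0 / (1 - cnj c * c)"
      by (rule DERIV_imp_deriv)
    moreover have "norm (1 - cnj c * c) = 1 - (norm c)\<^sup>2"
      unfolding cc using pos by (metis abs_of_pos norm_of_real of_real_1 of_real_diff)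
    ultimately have "norm (deriv h 0) / (1 - (norm c)\<^sup>2) \<le> 1"
      using Schwarz_Lemma(2)[OF holk k0 k_lt, of 0] by (simp add: norm_divide)
    then show ?thesis using pos by (simp add: c1 c2 del: One_nat_def)
  qed
qed

section \<open>Univalent functions with symmetric image\<close>

lemma taylor_coeff_cnj_cnj:
  assumes hol: "f holomorphic_on unit_disk"
  shows "taylor_coeff (cnj \<circ> f \<circ> cnj) n = cnj (taylor_coeff f n)"
proof -
  have "(cnj \<circ> f \<circ> cnj) has_fps_expansion Abs_fps (\<lambda>n. cnj (taylor_coeff f n))"
  proof (rule has_fps_expansionI)
    show "\<forall>\<^sub>F u in nhds 0. (\<lambda>n. fps_nth (Abs_fps (\<lambda>n. cnj (taylor_coeff f n))) n * u ^ n)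
        sums (cnj \<circ> f \<circ> cnj) u"
    proof (rule eventually_nhds_0_unit_disk)
      fix u assume "u \<in> unit_disk"
      then have "cnj u \<in> unit_disk" by simp
      from holomorphic_power_series[OF hol this]
      have "(\<lambda>n. taylor_coeff f n * cnj u ^ n) sums f (cnj u)"
        by (simp add: taylor_coeff_def)
      then have "(\<lambda>n. cnj (taylor_coeff f n * cnj u ^ n)) sums cnj (f (cnj u))"
        by (simp only: sums_cnj)
      then show "(\<lambda>n. fps_nth (Abs_fps (\<lambda>n. cnj (taylor_coeff f n))) n * u ^ n)
          sums (cnj \<circ> f \<circ> cnj) u" by simp
    qed
  qed
  then show ?thesis by (simp add: taylor_coeff_eq_fps_nth)
qed

text \<open>
  The reflected function \<open>cnj \<circ> \<phi> \<circ> cnj\<close> is holomorphic with values in the image of \<open>\<phi>\<close>, and it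
  has the same value and derivative at 0. Followed by the inverse of \<open>\<phi>\<close> it is a self-map of the
  disk that fixes 0 with derivative 1, which is the identity by the Schwarz lemma. So \<open>\<phi>\<close> equals
  its reflection, whose coefficients are the conjugates of those of \<open>\<phi>\<close>.
\<close>

lemma symmetric_univalent_coeff_real:
  assumes hol: "\<phi> holomorphic_on unit_disk" and inj: "inj_on \<phi> unit_disk"
    and sym: "cnj ` (\<phi> ` unit_disk) = \<phi> ` unit_disk"
    and r0: "\<phi> 0 \<in> \<real>" and r1: "deriv \<phi> 0 \<in> \<real>"
  shows "taylor_coeff \<phi> n \<in> \<real>"
proof -
  define \<phi>' where "\<phi>' = cnj \<circ> \<phi> \<circ> cnj"
  obtain g where holg: "g holomorphic_on \<phi> ` unit_disk"
    and dg: "\<And>z. z \<in> unit_disk \<Longrightarrow> deriv \<phi> z * deriv g (\<phi> z) = 1"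
    and g: "\<And>z. z \<in> unit_disk \<Longrightarrow> g (\<phi> z) = z"
    by (rule holomorphic_has_inverse[OF hol _ inj]) auto
  have im: "\<phi>' z \<in> \<phi> ` unit_disk" if "z \<in> unit_disk" for z
  proof -
    have "cnj z \<in> unit_disk" using that by simp
    then have "cnj (\<phi> (cnj z)) \<in> cnj ` (\<phi> ` unit_disk)" by blast
    then show ?thesis unfolding sym by (simp add: \<phi>'_def)
  qed
  have cnj_disk: "cnj ` unit_disk = unit_disk"
    unfolding image_cnj_conv_vimage_cnj by auto
  have hol': "\<phi>' holomorphic_on unit_disk"
    unfolding \<phi>'_def by (rule holomorphic_on_compose_cnj_cnj) (simp_all add: cnj_disk hol)
  define \<psi> where "\<psi> = g \<circ> \<phi>'"
  have hol\<psi>: "\<psi> holomorphic_on unit_disk"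
    unfolding \<psi>_def using im by (intro holomorphic_on_compose_gen[OF hol' holg]) auto
  have \<phi>\<psi>: "\<phi> (\<psi> z) = \<phi>' z" and \<psi>_in: "\<psi> z \<in> unit_disk" if "z \<in> unit_disk" for z
    using im[OF that] g by (auto simp: \<psi>_def)
  have \<phi>'0: "\<phi>' 0 = \<phi> 0" using r0 by (simp add: \<phi>'_def Reals_cnj_iff)
  have \<psi>0: "\<psi> 0 = 0" using g[of 0] \<phi>'0 by (simp add: \<psi>_def)
  have opn: "open (\<phi> ` unit_disk)"
    by (rule open_mapping_thm3[OF hol _ inj]) simp
  have d': "(\<phi>' has_field_derivative deriv \<phi> 0) (at 0)"
  proof -
    have "(\<phi> has_field_derivative deriv \<phi> 0) (at (cnj 0))"
      using holomorphic_derivI[OF hol] by simp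
    from has_field_derivative_cnj_cnj[OF this] show ?thesis
      using r1 by (simp add: \<phi>'_def Reals_cnj_iff)
  qed
  have "(g has_field_derivative deriv g (\<phi> 0)) (at (\<phi>' 0))"
    unfolding \<phi>'0 using holomorphic_derivI[OF holg opn] by simp
  from DERIV_chain[OF this d'] have d\<psi>: "deriv \<psi> 0 = 1"
    using dg[of 0] by (intro DERIV_imp_deriv) (simp add: \<psi>_def mult.commute)
  have "\<exists>\<alpha>. (\<forall>z. norm z < 1 \<longrightarrow> \<psi> z = \<alpha> * z) \<and> norm \<alpha> = 1"
    using \<psi>_in d\<psi> by (intro Schwarz_Lemma(3)[OF hol\<psi> \<psi>0, of 0]) auto
  then obtain \<alpha> where \<alpha>: "\<And>z. norm z < 1 \<Longrightarrow> \<psi> z = \<alpha> * z" by blast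
  have "(\<psi> has_field_derivative \<alpha>) (at 0)"
    by (rule has_field_derivative_transform_within_open[of "\<lambda>z. \<alpha> * z" _ _ unit_disk])
      (auto intro!: derivative_eq_intros simp: \<alpha>)
  then have "\<alpha> = 1" using d\<psi> DERIV_imp_deriv by metis
  then have "\<And>z. z \<in> unit_disk \<Longrightarrow> \<phi>' z = \<phi> z"
    using \<phi>\<psi> \<alpha> by (metis dist_0_norm mem_ball mult_1)
  then have "\<forall>\<^sub>F z in nhds 0. \<phi>' z = \<phi> z"
    by (rule eventually_nhds_0_unit_disk)
  then have "taylor_coeff \<phi>' n = taylor_coeff \<phi> n"
    by (simp add: taylor_coeff_def higher_deriv_cong_ev)
  then show ?thesis
    by (simp add: \<phi>'_def taylor_coeff_cnj_cnj[OF hol] Reals_cnj_iff)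
qed

section \<open>Initial coefficients of the class\<close>

text \<open>
  Up to the second order, the numerator is \<open>2 + 8a\<^sub>2 z + 18a\<^sub>3 z\<^sup>2\<close> and the denominator, in which
  the even part of \<open>f\<close> cancels, is \<open>2 + 6a\<^sub>3 z\<^sup>2\<close>. Hence the quotient is
  \<open>1 + 4a\<^sub>2 z + 6a\<^sub>3 z\<^sup>2\<close>, to be compared with \<open>\<phi> \<circ> \<omega>\<close>.
\<close>

lemma class_Cs_coeffs:
  assumes f: "f \<in> class_A"
    and hol: "\<phi> holomorphic_on unit_disk" and \<phi>0: "\<phi> 0 = 1"
    and hol\<omega>: "\<omega> holomorphic_on unit_disk" and \<omega>0: "\<omega> 0 = 0"
    and eq: "\<And>z. z \<in> unit_disk \<Longrightarrow>
      deriv (\<lambda>w. 2 * w * deriv f w) z / deriv (\<lambda>w. f w - f (- w)) z = \<phi> (\<omega> z)"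
  shows "taylor_coeff f 2 = taylor_coeff \<phi> 1 * taylor_coeff \<omega> 1 / 4"
    and "taylor_coeff f 3 =
      (taylor_coeff \<phi> 1 * taylor_coeff \<omega> 2 + taylor_coeff \<phi> 2 * (taylor_coeff \<omega> 1)\<^sup>2) / 6"
proof -
  define F \<Phi> \<Omega> where "F = fps_expansion f 0" and "\<Phi> = fps_expansion \<phi> 0"
    and "\<Omega> = fps_expansion \<omega> 0"
  have nths: "fps_nth F n = taylor_coeff f n" "fps_nth \<Phi> n = taylor_coeff \<phi> n"
    "fps_nth \<Omega> n = taylor_coeff \<omega> n" for n
    by (simp_all add: F_def \<Phi>_def \<Omega>_def fps_expansion_def taylor_coeff_def)
  have expf: "f has_fps_expansion F"
    unfolding F_def using f
    by (intro has_fps_expansion_fps_expansion[of unit_disk]) (auto simp: class_A_def)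
  have exp\<phi>: "\<phi> has_fps_expansion \<Phi>" and exp\<omega>: "\<omega> has_fps_expansion \<Omega>"
    unfolding \<Phi>_def \<Omega>_def using hol hol\<omega>
    by (auto intro!: has_fps_expansion_fps_expansion[of unit_disk])
  have F0: "fps_nth F 0 = 0" "fps_nth F (Suc 0) = 1"
    using f by (auto simp: nths class_A_def taylor_coeff_def)
  have \<Phi>0: "fps_nth \<Phi> 0 = 1" and \<Omega>0: "fps_nth \<Omega> 0 = 0"
    by (simp_all add: nths taylor_coeff_def \<phi>0 \<omega>0)
  define N where "N = fps_deriv (fps_const 2 * fps_X * fps_deriv F)"
  define D where "D = fps_deriv (F - fps_compose F (- fps_X))"
  have "(\<lambda>w. 2 * w * deriv f w) has_fps_expansion fps_const 2 * fps_X * fps_deriv F"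
    by (intro fps_expansion_intros expf)
  then have expN: "deriv (\<lambda>w. 2 * w * deriv f w) has_fps_expansion N"
    unfolding N_def by (rule has_fps_expansion_deriv)
  have "(f \<circ> (\<lambda>w. - w)) has_fps_expansion fps_compose F (- fps_X)"
    by (intro fps_expansion_intros expf) simp
  then have "(\<lambda>w. f w - f (- w)) has_fps_expansion F - fps_compose F (- fps_X)"
    unfolding o_def by (intro fps_expansion_intros expf)
  then have expD: "deriv (\<lambda>w. f w - f (- w)) has_fps_expansion D"
    unfolding D_def by (rule has_fps_expansion_deriv)
  have Dn: "fps_nth D 0 = 2" "fps_nth D 1 = 0" "fps_nth D 2 = 6 * fps_nth F 3"
    by (simp_all add: D_def fps_compose_uminus' F0 eval_nat_numeral)
  have Nn: "fps_nth N 0 = 2" "fps_nth N 1 = 8 * fps_nth F 2" "fps_nth N 2 = 18 * fps_nth F 3"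
    by (simp_all add: N_def F0 eval_nat_numeral mult.assoc)
  have "(\<lambda>z. deriv (\<lambda>w. 2 * w * deriv f w) z / deriv (\<lambda>w. f w - f (- w)) z) has_fps_expansion N / D"
    using Dn by (intro has_fps_expansion_divide' expN expD) auto
  moreover have "\<forall>\<^sub>F z in nhds 0. (\<phi> \<circ> \<omega>) z =
      deriv (\<lambda>w. 2 * w * deriv f w) z / deriv (\<lambda>w. f w - f (- w)) z"
    by (rule eventually_nhds_0_unit_disk) (simp add: eq)
  ultimately have "(\<phi> \<circ> \<omega>) has_fps_expansion N / D"
    by (subst has_fps_expansion_cong[OF _ refl])
  moreover have "(\<phi> \<circ> \<omega>) has_fps_expansion fps_compose \<Phi> \<Omega>"
    by (intro has_fps_expansion_compose exp\<phi> exp\<omega> \<Omega>0)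
  ultimately have "N / D = fps_compose \<Phi> \<Omega>"
    by (rule fps_expansion_unique_complex)
  moreover have "N / D * D = N"
    using Dn by (simp add: fps_divide_unit mult.assoc inverse_mult_eq_1)
  ultimately have ND: "N = fps_compose \<Phi> \<Omega> * D" by simp
  have C: "fps_nth (fps_compose \<Phi> \<Omega>) 0 = 1"
    "fps_nth (fps_compose \<Phi> \<Omega>) 1 = fps_nth \<Phi> 1 * fps_nth \<Omega> 1"
    "fps_nth (fps_compose \<Phi> \<Omega>) 2 = fps_nth \<Phi> 1 * fps_nth \<Omega> 2 + fps_nth \<Phi> 2 * (fps_nth \<Omega> 1)\<^sup>2"
    by (simp_all add: fps_compose_nth \<Phi>0 \<Omega>0 eval_nat_numeral fps_mult_nth)
  have "8 * fps_nth F 2 = 2 * (fps_nth \<Phi> 1 * fps_nth \<Omega> 1)"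
    using arg_cong[OF ND, of "\<lambda>A. fps_nth A 1"] C Dn unfolding Nn
    by (simp add: fps_mult_nth)
  then show "taylor_coeff f 2 = taylor_coeff \<phi> 1 * taylor_coeff \<omega> 1 / 4"
    by (simp add: nths field_simps)
  have "fps_nth N 2 = fps_nth D 2 + 2 * fps_nth (fps_compose \<Phi> \<Omega>) 2"
    using arg_cong[OF ND, of "\<lambda>A. fps_nth A 2"] C(1) Dn(1,2)
    by (simp add: fps_mult_nth eval_nat_numeral)
  then show "taylor_coeff f 3 =
      (taylor_coeff \<phi> 1 * taylor_coeff \<omega> 2 + taylor_coeff \<phi> 2 * (taylor_coeff \<omega> 1)\<^sup>2) / 6"
    unfolding C Dn Nn nths by (simp only: field_simps) algebra
qed


section \<open>The extremal function\<close>

text \<open>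
  Writing \<open>g\<close> for the even part of \<open>f'\<close>, the equation to be solved is \<open>(zf')' = \<phi>g\<close>. Its even
  part is \<open>(zg)' = \<phi>\<^sub>e g\<close> with \<open>\<phi>\<^sub>e\<close> the even part of \<open>\<phi>\<close>, a linear equation for \<open>g\<close> alone:
  \<open>g'/g = (\<phi>\<^sub>e - 1)/z\<close>. So \<open>g\<close> is the exponential of a primitive, in particular without zeros,
  and it is even because the integrand is odd. Integrating \<open>\<phi>g\<close>, dividing by \<open>z\<close> and
  integrating again produces \<open>f\<close>. It remains to see that the even part of \<open>f'\<close> is indeed \<open>g\<close>,
  which holds because both satisfy the even part of the equation.
\<close>

lemma class_Cs_ode_solvable:
  assumes hol: "\<phi> holomorphic_on unit_disk" and \<phi>0: "\<phi> 0 = 1"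
  obtains f where "f \<in> class_A"
    and "\<And>z. z \<in> unit_disk \<Longrightarrow>
      deriv (\<lambda>w. 2 * w * deriv f w) z / deriv (\<lambda>w. f w - f (- w)) z = \<phi> z"
proof -
  note D\<phi> = holomorphic_derivI[OF hol open_ball]
  define e where "e = (\<lambda>z. (\<phi> z + \<phi> (- z)) / 2 - 1)"
  have hol_minus: "(\<lambda>z. \<phi> (- z)) holomorphic_on unit_disk"
  proof -
    have "uminus holomorphic_on unit_disk"
      using holomorphic_on_minus[OF holomorphic_on_ident] by simp
    moreover have "uminus ` unit_disk \<subseteq> unit_disk" by auto
    ultimately show ?thesis
      using holomorphic_on_compose_gen[of uminus unit_disk \<phi> unit_disk] hol by (simp add: o_def)
  qed
  have hole: "e holomorphic_on unit_disk"
    unfolding e_def by (intro holomorphic_intros hol hol_minus) auto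
  have e0: "e 0 = 0" by (simp add: e_def \<phi>0)
  \<comment> \<open>Division by \<open>z\<close>: the logarithmic derivative \<open>q\<close> of \<open>g\<close> is holomorphic at 0 as well.\<close>
  obtain q where holq: "q holomorphic_on unit_disk"
    and q: "\<And>z. norm z < 1 \<Longrightarrow> e z = z * q z" and q0: "deriv e 0 = q 0"
    by (rule Schwarz3[OF hole e0]) blast
  have "((\<lambda>z. \<phi> (- z)) has_field_derivative - deriv \<phi> 0) (at 0)"
    using DERIV_chain2[of \<phi> "deriv \<phi> 0" uminus 0 "-1" UNIV] D\<phi>[of 0]
      DERIV_minus[OF DERIV_ident, of 0 UNIV] by simp
  then have "(e has_field_derivative (deriv \<phi> 0 + - deriv \<phi> 0) / 2 - 0) (at 0)"
    unfolding e_def by (intro DERIV_diff DERIV_cdivide DERIV_add D\<phi> DERIV_const) auto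
  then have q_zero: "q 0 = 0"
    using DERIV_imp_deriv q0 by fastforce
  have q_odd: "q (- z) = - q z" if "norm z < 1" for z
  proof (cases "z = 0")
    case False
    have "e (- z) = e z" by (simp add: e_def add.commute)
    then have "- (z * q (- z)) = z * q z" using q[OF that] q[of "- z"] that by simp
    then have "z * q (- z) = z * (- q z)" by (metis minus_minus mult_minus_right)
    then show ?thesis using False mult_left_cancel by blast
  qed (simp add: q_zero)
  obtain P0 where P0: "\<And>z. z \<in> unit_disk \<Longrightarrow> (P0 has_field_derivative q z) (at z within unit_disk)"
    using holomorphic_convex_primitive'[OF convex_ball open_ball holq] by blast
  define P where "P = (\<lambda>z. P0 z - P0 0)"
  have DP: "(P has_field_derivative q z) (at z)" if "z \<in> unit_disk" for z
    using P0[OF that] that unfolding P_def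
    by (auto intro!: derivative_eq_intros simp: at_within_open[OF _ open_ball])
  have P_even: "P (- z) = P z" if "z \<in> unit_disk" for z
  proof -
    have "((\<lambda>z. P z - P (- z)) has_field_derivative 0) (at z within unit_disk)"
      if "z \<in> unit_disk" for z
    proof -
      have "((\<lambda>z. P (- z)) has_field_derivative q (- z) * (- 1)) (at z)"
        using that by (intro DERIV_chain2[of P] DP) (auto intro!: derivative_eq_intros)
      then have "((\<lambda>z. P z - P (- z)) has_field_derivative q z - q (- z) * (- 1)) (at z)"
        by (intro derivative_intros DP that)
      then show ?thesis
        using that by (simp add: q_odd has_field_derivative_at_within)
    qed
    from has_field_derivative_zero_constant[OF convex_ball this]
    obtain c where c: "\<And>z. z \<in> unit_disk \<Longrightarrow> P z - P (- z) = c" by blast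
    have "c = 0" using c[of 0] by simp
    then show ?thesis using c[OF that] by simp
  qed
  define g where "g = (\<lambda>z. exp (P z))"
  have g0: "g 0 = 1" by (simp add: g_def P_def)
  have g_nz: "g z \<noteq> 0" for z by (simp add: g_def)
  have g_even: "g (- z) = g z" if "z \<in> unit_disk" for z
    using P_even[OF that] by (simp add: g_def)
  have Dg: "(g has_field_derivative g z * q z) (at z)" if "z \<in> unit_disk" for z
    unfolding g_def by (rule derivative_eq_intros DP that | simp)+
  have holg: "g holomorphic_on unit_disk"
    unfolding holomorphic_on_open[OF open_ball] using Dg by blast
  have hol\<phi>g: "(\<lambda>z. \<phi> z * g z) holomorphic_on unit_disk"
    by (intro holomorphic_intros hol holg)
  \<comment> \<open>The function \<open>k\<close> will be \<open>zf'(z)\<close>, and \<open>h\<close> will be \<open>f'\<close>.\<close>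
  obtain k0 where k0: "\<And>z. z \<in> unit_disk \<Longrightarrow>
      (k0 has_field_derivative \<phi> z * g z) (at z within unit_disk)"
    using holomorphic_convex_primitive'[OF convex_ball open_ball hol\<phi>g] by blast
  define k where "k = (\<lambda>z. k0 z - k0 0)"
  have Dk: "(k has_field_derivative \<phi> z * g z) (at z)" if "z \<in> unit_disk" for z
    using k0[OF that] that unfolding k_def
    by (auto intro!: derivative_eq_intros simp: at_within_open[OF _ open_ball])
  have holk: "k holomorphic_on unit_disk"
    unfolding holomorphic_on_open[OF open_ball] using Dk by blast
  obtain h where holh: "h holomorphic_on unit_disk"
    and kh: "\<And>z. norm z < 1 \<Longrightarrow> k z = z * h z" and h0: "deriv k 0 = h 0"
    by (rule Schwarz3[OF holk]) (auto simp: k_def)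
  have h_zero: "h 0 = 1"
    using DERIV_imp_deriv[OF Dk[of 0]] h0 by (simp add: \<phi>0 g0)
  have k_odd_part: "k z - k (- z) = 2 * z * g z" if "z \<in> unit_disk" for z
  proof -
    have "((\<lambda>z. k z - k (- z) - 2 * z * g z) has_field_derivative 0) (at z within unit_disk)"
      if z: "z \<in> unit_disk" for z
    proof -
      have "((\<lambda>z. k (- z)) has_field_derivative (\<phi> (- z) * g (- z)) * (- 1)) (at z)"
        using z by (intro DERIV_chain2[of k] Dk) (auto intro!: derivative_eq_intros)
      then have "((\<lambda>z. k z - k (- z) - 2 * z * g z) has_field_derivative
          \<phi> z * g z - (\<phi> (- z) * g (- z)) * (- 1) - (2 * g z + g z * q z * (2 * z))) (at z)"
        by (auto intro!: derivative_eq_intros Dk[OF z] Dg[OF z])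
      moreover have "\<phi> z * g z - (\<phi> (- z) * g (- z)) * (- 1) - (2 * g z + g z * q z * (2 * z))
          = 2 * g z * (e z - z * q z)"
        using g_even[OF z] by (simp add: e_def field_simps)
      ultimately show ?thesis
        using q[of z] z by (simp add: has_field_derivative_at_within)
    qed
    from has_field_derivative_zero_constant[OF convex_ball this]
    obtain c where c: "\<And>z. z \<in> unit_disk \<Longrightarrow> k z - k (- z) - 2 * z * g z = c" by blast
    have "c = 0" using c[of 0] by simp
    then show ?thesis using c[OF that] by simp
  qed
  have h_even_part: "h z + h (- z) = 2 * g z" if "z \<in> unit_disk" for z
  proof (cases "z = 0")
    case False
    have "z * (h z + h (- z)) = z * (2 * g z)"
      using k_odd_part[OF that] kh[of z] kh[of "- z"] that by (simp add: algebra_simps)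
    then show ?thesis using False mult_left_cancel by blast
  qed (simp add: h_zero g0)
  obtain f0 where f0: "\<And>z. z \<in> unit_disk \<Longrightarrow> (f0 has_field_derivative h z) (at z within unit_disk)"
    using holomorphic_convex_primitive'[OF convex_ball open_ball holh] by blast
  define f where "f = (\<lambda>z. f0 z - f0 0)"
  have Df: "(f has_field_derivative h z) (at z)" if "z \<in> unit_disk" for z
    using f0[OF that] that unfolding f_def
    by (auto intro!: derivative_eq_intros simp: at_within_open[OF _ open_ball])
  have df: "deriv f z = h z" if "z \<in> unit_disk" for z
    using Df[OF that] by (rule DERIV_imp_deriv)
  show ?thesis
  proof (rule that[of f])
    have "f holomorphic_on unit_disk"
      unfolding holomorphic_on_open[OF open_ball] using Df by blast
    then show "f \<in> class_A"
      using df[of 0] h_zero by (simp add: class_A_def) (simp add: f_def)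
    fix z assume z: "z \<in> unit_disk"
    have "((\<lambda>w. 2 * k w) has_field_derivative 2 * (\<phi> z * g z)) (at z)"
      by (intro DERIV_cmult Dk z)
    then have "((\<lambda>w. 2 * w * deriv f w) has_field_derivative 2 * (\<phi> z * g z)) (at z)"
      by (rule has_field_derivative_transform_within_open[of _ _ _ unit_disk])
        (use z in \<open>auto simp: df kh\<close>)
    then have num: "deriv (\<lambda>w. 2 * w * deriv f w) z = 2 * (\<phi> z * g z)"
      by (rule DERIV_imp_deriv)
    have "((\<lambda>w. f (- w)) has_field_derivative h (- z) * (- 1)) (at z)"
      using z by (intro DERIV_chain2[of f] Df) (auto intro!: derivative_eq_intros)
    then have "((\<lambda>w. f w - f (- w)) has_field_derivative h z - h (- z) * (- 1)) (at z)"
      by (intro derivative_intros Df z)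
    then have "deriv (\<lambda>w. f w - f (- w)) z = 2 * g z"
      using h_even_part[OF z] DERIV_imp_deriv by fastforce
    with num show "deriv (\<lambda>w. 2 * w * deriv f w) z / deriv (\<lambda>w. f w - f (- w)) z = \<phi> z"
      by (simp add: g_nz)
  qed
qed

section \<open>Minimising the determinant\<close>

lemma T31_eq_schwarz_coeffs:
  fixes c1 c2 :: complex and b1 b2 :: real
  assumes a2: "taylor_coeff f 2 = of_real b1 * c1 / 4"
    and a3: "taylor_coeff f 3 = (of_real b1 * c2 + of_real b2 * c1\<^sup>2) / 6"
  shows "144 * (T31 f - 1) =
    - 18 * b1\<^sup>2 * (cmod c1)\<^sup>2 + (3 * b1\<^sup>2 * b2 - 4 * b2\<^sup>2) * (cmod c1) ^ 4
    + b1 * (3 * b1\<^sup>2 - 8 * b2) * Re (c1\<^sup>2 * cnj c2) - 4 * b1\<^sup>2 * (cmod c2)\<^sup>2"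
proof -
  have p4: "x ^ 4 = (x\<^sup>2)\<^sup>2" for x :: real by simp
  obtain x y where c1: "c1 = Complex x y" by (cases c1)
  obtain u v where c2: "c2 = Complex u v" by (cases c2)
  show ?thesis
    unfolding T31_def Let_def a2 a3 p4 cmod_power2 c1 c2
    by (simp add: power2_eq_square) (simp add: field_simps)
qed

text \<open>
  The right side minus the left side is a quadratic polynomial in \<open>b2\<close> with leading coefficient 8
  and minimum \<open>b1\<^sup>2 (17 - 3 b1 - (3 b1 - 4)\<^sup>2 / 8)\<close>, at \<open>b2 = (3 b1\<^sup>2 - 4 b1) / 8\<close>. For
  \<open>0 < b1 \<le> 2\<close> the bracket is at least \<open>17 - 6 - 2\<close>.
\<close>

lemma ma_minda_quadratic_bound:
  fixes b1 b2 :: real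
  assumes "0 < b1" "b1 \<le> 2"
  shows "2 * (3 * b1\<^sup>2 * b2 - 4 * b2\<^sup>2) + b1 * (3 * b1\<^sup>2 - 8 * b2) < 17 * b1\<^sup>2"
proof -
  have "\<bar>3 * b1 - 4\<bar> \<le> 4" using assms by linarith
  then have "(3 * b1 - 4)\<^sup>2 \<le> 4\<^sup>2" by (rule power2_le_iff_abs_le[THEN iffD2, rotated]) simp
  then have "0 < 17 - 3 * b1 - (3 * b1 - 4)\<^sup>2 / 8" using assms by simp
  then have "0 < b1\<^sup>2 * (17 - 3 * b1 - (3 * b1 - 4)\<^sup>2 / 8)" using assms by simp
  also have "\<dots> \<le> b1\<^sup>2 * (17 - 3 * b1 - (3 * b1 - 4)\<^sup>2 / 8) + 8 * (b2 - (3 * b1\<^sup>2 - 4 * b1) / 8)\<^sup>2"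
    by simp
  also have "\<dots> = 17 * b1\<^sup>2 - (2 * (3 * b1\<^sup>2 * b2 - 4 * b2\<^sup>2) + b1 * (3 * b1\<^sup>2 - 8 * b2))"
    by (simp add: field_simps power2_eq_square)
  finally show ?thesis by simp
qed

text \<open>
  Here \<open>t\<close>, \<open>s\<close> and \<open>w\<close> stand for \<open>|c\<^sub>1|\<^sup>2\<close>, \<open>|c\<^sub>2|\<close> and \<open>Re (c\<^sub>1\<^sup>2 cnj c\<^sub>2)\<close>. The right side
  decreases if \<open>s\<close> becomes \<open>1 - t\<close> and \<open>w\<close> becomes \<open>- t (1 - t)\<close>. What is left is quadratic in
  \<open>t\<close>; its difference to the value at \<open>t = 1\<close> is \<open>1 - t\<close> times an affine function of \<open>t\<close>, which
  is nonnegative because it is so at both ends of \<open>[0,1]\<close>.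
\<close>

lemma schwarz_quadratic_min:
  fixes b1 b2 t s w :: real
  assumes b1: "0 < b1" "b1 \<le> 2" and b: "8 * b2 \<le> 3 * b1\<^sup>2"
    and t: "0 \<le> t" "t \<le> 1" and s: "0 \<le> s" "s \<le> 1 - t" and w: "- (t * s) \<le> w"
  shows "- 18 * b1\<^sup>2 + (3 * b1\<^sup>2 * b2 - 4 * b2\<^sup>2) \<le>
    - 18 * b1\<^sup>2 * t + (3 * b1\<^sup>2 * b2 - 4 * b2\<^sup>2) * t\<^sup>2 + b1 * (3 * b1\<^sup>2 - 8 * b2) * w - 4 * b1\<^sup>2 * s\<^sup>2"
proof -
  define A where "A = 3 * b1\<^sup>2 * b2 - 4 * b2\<^sup>2"
  define K where "K = b1 * (3 * b1\<^sup>2 - 8 * b2)"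
  have K0: "0 \<le> K" using b1 b by (simp add: K_def)
  have "t * s \<le> t * (1 - t)" using t s by (intro mult_left_mono)
  with w have "- (t * (1 - t)) \<le> w" by linarith
  from mult_left_mono[OF this K0] have 1: "- (K * (t * (1 - t))) \<le> K * w" by simp
  have 2: "b1\<^sup>2 * s\<^sup>2 \<le> b1\<^sup>2 * (1 - t)\<^sup>2"
    using s by (intro mult_left_mono power_mono) auto
  have at_1: "0 \<le> 18 * b1\<^sup>2 - (2 * A + K)"
    using ma_minda_quadratic_bound[OF b1, of b2] zero_le_power2[of b1]
    unfolding A_def K_def by linarith
  have at_0: "0 \<le> 14 * b1\<^sup>2 - A"
    using at_1 K0 zero_le_power2[of b1] by linarith
  have "0 \<le> (1 - t) * ((1 - t) * (14 * b1\<^sup>2 - A) + t * (18 * b1\<^sup>2 - (2 * A + K)))"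
    using t at_0 at_1 by (intro mult_nonneg_nonneg add_nonneg_nonneg) simp_all
  then have "- 18 * b1\<^sup>2 + A \<le> - 18 * b1\<^sup>2 * t + A * t\<^sup>2 - K * (t * (1 - t)) - 4 * (b1\<^sup>2 * (1 - t)\<^sup>2)"
    by (simp add: algebra_simps power2_eq_square power3_eq_cube)
  with 1 2 show ?thesis unfolding A_def K_def by linarith
qed

theorem theorem3p4:
  fixes \<phi> :: "complex \<Rightarrow> complex" and B1 B2 \<sigma>2 :: real
  assumes "ma_minda \<phi>"
    and "B1 = Re (taylor_coeff \<phi> 1)"
    and "B2 = Re (taylor_coeff \<phi> 2)"
    and "3 * B1^2 \<ge> 8 * B2"
    and "\<sigma>2 = 2 * (17 * B1^2 + 3 * B1^3 - 8 * B1 * B2) /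
              (3 * B1^3 - 8 * B1 * B2 + 3 * B1^2 * B2 - 4 * B2^2)"
  shows
    "(\<sigma>2 \<notin> {0..4} \<longrightarrow>
       (\<forall>f\<in>class_Cs \<phi>. T31 f \<ge>
          min (1 - B1^2 / 144) (1 + 1 / 144 * (3 * B1^2 * (B2 - 6) - 4 * B2^2))) \<and>
       (\<exists>f\<in>class_Cs \<phi>. T31 f =
          min (1 - B1^2 / 144) (1 + 1 / 144 * (3 * B1^2 * (B2 - 6) - 4 * B2^2)))) \<and>
     (\<sigma>2 = 4 \<longrightarrow>
       (\<forall>f\<in>class_Cs \<phi>. T31 f \<ge> 1 + 1 / 144 * (3 * B1^2 * (B2 - 6) - 4 * B2^2)) \<and>
       (\<exists>f\<in>class_Cs \<phi>. T31 f = 1 + 1 / 144 * (3 * B1^2 * (B2 - 6) - 4 * B2^2))) \<and>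
     (\<sigma>2 \<in> {0<..<4} \<longrightarrow>
       (\<forall>f\<in>class_Cs \<phi>. T31 f \<ge>
          1 - B1^2 * (9 * B1^4 + 114 * B1^3 + 289 * B1^2 - 304 * B1 * B2
                       - 36 * B1^2 * B2 + 48 * B2^2) /
              (576 * (3 * B1^3 - 8 * B1 * B2 + 3 * B1^2 * B2 - 4 * B2^2))))"
proof -
  have hol: "\<phi> holomorphic_on unit_disk" and inj: "inj_on \<phi> unit_disk" and \<phi>0: "\<phi> 0 = 1"
    and pos: "\<And>z. z \<in> unit_disk \<Longrightarrow> Re (\<phi> z) > 0"
    and sym: "cnj ` (\<phi> ` unit_disk) = \<phi> ` unit_disk"
    and real1: "taylor_coeff \<phi> 1 \<in> \<real>" and B1_pos: "B1 > 0"
    using assms(1,2) by (auto simp: ma_minda_def)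
  have deriv1: "deriv \<phi> 0 = taylor_coeff \<phi> 1" by (simp add: taylor_coeff_def)
  have B1: "taylor_coeff \<phi> 1 = of_real B1" using real1 assms(2) by simp
  have "taylor_coeff \<phi> 2 \<in> \<real>"
    using symmetric_univalent_coeff_real[OF hol inj sym] real1 by (simp add: \<phi>0 deriv1)
  then have B2: "taylor_coeff \<phi> 2 = of_real B2" using assms(3) by simp
  have B1_le: "B1 \<le> 2"
    using caratheodory_first_coeff[OF hol \<phi>0 pos] B1_pos by (simp add: deriv1 B1 del: One_nat_def)
  have B: "8 * B2 \<le> 3 * B1\<^sup>2" using assms(4) .
  define m where "m = 1 + 1 / 144 * (3 * B1^2 * (B2 - 6) - 4 * B2^2)"

  have lower: "m \<le> T31 f" if f: "f \<in> class_Cs \<phi>" for f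
  proof -
    from f obtain \<omega> where \<omega>: "\<omega> holomorphic_on unit_disk" "\<omega> ` unit_disk \<subseteq> unit_disk" "\<omega> 0 = 0"
      and eq: "\<And>z. z \<in> unit_disk \<Longrightarrow>
        deriv (\<lambda>w. 2 * w * deriv f w) z / deriv (\<lambda>w. f w - f (- w)) z = \<phi> (\<omega> z)"
      by (auto simp: class_Cs_def subordinate_def)
    have fA: "f \<in> class_A" using f by (simp add: class_Cs_def)
    define c1 c2 where "c1 = taylor_coeff \<omega> 1" and "c2 = taylor_coeff \<omega> 2"
    note coeffs = class_Cs_coeffs[OF fA hol \<phi>0 \<omega>(1,3) eq, unfolded B1 B2, folded c1_def c2_def]
    have lt: "norm (\<omega> z) < 1" if "z \<in> unit_disk" for z
      using subsetD[OF \<omega>(2) imageI[OF that]] by simp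
    note S = schwarz_second_coeff[OF \<omega>(1,3) lt, folded c1_def c2_def]
    have "(cmod c1)\<^sup>2 \<le> 1" using S(2) by (simp add: power_le_one)
    moreover have "- ((cmod c1)\<^sup>2 * cmod c2) \<le> Re (c1\<^sup>2 * cnj c2)"
      using abs_Re_le_cmod[of "c1\<^sup>2 * cnj c2"] by (simp add: norm_mult norm_power)
    ultimately have "- 18 * B1\<^sup>2 + (3 * B1\<^sup>2 * B2 - 4 * B2\<^sup>2) \<le>
        - 18 * B1\<^sup>2 * (cmod c1)\<^sup>2 + (3 * B1\<^sup>2 * B2 - 4 * B2\<^sup>2) * (cmod c1) ^ 4
        + B1 * (3 * B1\<^sup>2 - 8 * B2) * Re (c1\<^sup>2 * cnj c2) - 4 * B1\<^sup>2 * (cmod c2)\<^sup>2"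
      using schwarz_quadratic_min[OF B1_pos B1_le B, of "(cmod c1)\<^sup>2" "cmod c2" "Re (c1\<^sup>2 * cnj c2)"] S(1)
      by simp
    also have "\<dots> = 144 * (T31 f - 1)"
      by (rule T31_eq_schwarz_coeffs[OF coeffs, symmetric])
    finally have "- 18 * B1\<^sup>2 + (3 * B1\<^sup>2 * B2 - 4 * B2\<^sup>2) \<le> 144 * (T31 f - 1)" .
    then show ?thesis by (simp add: m_def field_simps)
  qed

  have attained: "\<exists>f\<in>class_Cs \<phi>. T31 f = m"
  proof -
    obtain f where f: "f \<in> class_A" and eq: "\<And>z. z \<in> unit_disk \<Longrightarrow>
        deriv (\<lambda>w. 2 * w * deriv f w) z / deriv (\<lambda>w. f w - f (- w)) z = \<phi> z"
      using class_Cs_ode_solvable[OF hol \<phi>0] by blast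
    have "f \<in> class_Cs \<phi>"
      unfolding class_Cs_def subordinate_def using f eq
      by (auto intro!: exI[of _ "\<lambda>z. z"] holomorphic_intros)
    moreover have id: "(\<lambda>z. z) has_fps_expansion fps_X"
      by (rule has_fps_expansion_fps_X)
    have "taylor_coeff f 2 = of_real B1 * 1 / 4"
      "taylor_coeff f 3 = (of_real B1 * 0 + of_real B2 * 1\<^sup>2) / 6"
      using class_Cs_coeffs[OF f hol \<phi>0 holomorphic_on_ident _ eq]
      by (simp_all add: taylor_coeff_eq_fps_nth[OF id] B1[simplified] B2)
    from T31_eq_schwarz_coeffs[OF this] have "T31 f = m"
      by (simp add: m_def field_simps)
    ultimately show ?thesis by blast
  qed

  have min_m: "min (1 - B1^2 / 144) m = m"
  proof -
    have "B1\<^sup>2 \<le> 2\<^sup>2" using B1_pos B1_le by (intro power_mono) auto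
    then have "B2 \<le> 3 / 2" using B by simp
    then have "B1\<^sup>2 * (3 * (B2 - 6)) \<le> B1\<^sup>2 * (- 1)" by (intro mult_left_mono) auto
    then have "3 * B1\<^sup>2 * (B2 - 6) - 4 * B2\<^sup>2 \<le> - B1\<^sup>2" using zero_le_power2[of B2] by linarith
    then show ?thesis by (simp add: m_def)
  qed

  \<comment> \<open>A value in \<open>(0,4)\<close> forces the denominator \<open>D\<close> to be positive and \<open>2 D > 17 B1\<^sup>2 + K\<close>, which
    is the opposite of the quadratic bound.\<close>
  have "\<sigma>2 \<notin> {0<..<4}"
  proof
    assume \<sigma>: "\<sigma>2 \<in> {0<..<4}"
    define K where "K = B1 * (3 * B1\<^sup>2 - 8 * B2)"
    define D where "D = 3 * B1\<^sup>2 * B2 - 4 * B2\<^sup>2 + K"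
    have K: "0 \<le> K" using B1_pos B by (simp add: K_def)
    have \<sigma>2: "\<sigma>2 = 2 * (17 * B1\<^sup>2 + K) / D"
      unfolding assms(5) by (simp add: D_def K_def algebra_simps power2_eq_square power3_eq_cube)
    have "0 < 17 * B1\<^sup>2 + K" using B1_pos K by (simp add: add_pos_nonneg)
    then have "D > 0" using \<sigma> by (simp add: \<sigma>2 zero_less_divide_iff)
    then have "17 * B1\<^sup>2 + K < 2 * D" using \<sigma> by (simp add: \<sigma>2 divide_less_eq)
    then show False using ma_minda_quadratic_bound[OF B1_pos B1_le, of B2]
      by (simp add: D_def K_def)
  qed
  then show ?thesis
    unfolding m_def[symmetric] min_m using lower attained by blast
qed

end
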